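(* Let $\bar{\epsilon}>0$. Consider a two-level quantum system with initial state $|0\rangle$, i.e. with initial Bloch vector $(x_0,y_0,z_0)=(0,0,1)$. Let $\epsilon:[0,\infty)\to\mathbb{R}$ be any (measurable) function with $|\epsilon(t)|\le\bar{\epsilon}$ for all $t$, and let $\tilde{\epsilon}\in\{+\bar{\epsilon},-\bar{\epsilon}\}$. Let $(x^{a}_{t},y^{a}_{t},z^{a}_{t})$ be the Bloch vector at time $t$ of the state evolving from $|0\rangle$ under the Hamiltonian $H^{a}=I_{z}+\epsilon(t)I_{x}$, and let $(x^{b}_{t},y^{b}_{t},z^{b}_{t})$ be the Bloch vector at time $t$ of the state evolving from $|0\rangle$ under the time-independent Hamiltonian $H^{b}=I_{z}+\tilde{\epsilon}I_{x}$. Then for every $t\in\left[0,\frac{\pi}{\sqrt{1+\bar{\epsilon}^{2}}}\right]$ we have $z^{a}_{t}\ge z^{b}_{t}$.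
   Context: Units with $\hbar=1$. The Pauli matrices are $\sigma_x=\begin{pmatrix}0&1\\1&0\end{pmatrix}$, $\sigma_y=\begin{pmatrix}0&-i\\i&0\end{pmatrix}$, $\sigma_z=\begin{pmatrix}1&0\\0&-1\end{pmatrix}$, and $I_x=\tfrac12\sigma_x$, $I_y=\tfrac12\sigma_y$, $I_z=\tfrac12\sigma_z$. The state $|0\rangle$ is the eigenvector of $\sigma_z$ with eigenvalue $1$. A state is described by a density operator $\rho$ evolving by $\dot\rho=-i[H,\rho]$ for the given (possibly time-dependent) Hamiltonian $H$; its Bloch vector is $(x,y,z)=(\mathrm{tr}(\rho\sigma_x),\mathrm{tr}(\rho\sigma_y),\mathrm{tr}(\rho\sigma_z))$, so that $\rho=\tfrac12(I+x\sigma_x+y\sigma_y+z\sigma_z)$. *)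

theory Defs
  imports "HOL-Analysis.Analysis"
begin

text \<open>2x2 complex matrices, indexed by the two-element type 2.
  Row/column 1 corresponds to basis state |0>, row/column 2 to |1>.\<close>

type_synonym cmat = "complex^2^2"

definition sigma_x :: cmat where
  "sigma_x = vector [vector [0, 1], vector [1, 0]]"

definition sigma_y :: cmat where
  "sigma_y = vector [vector [0, - \<i>], vector [\<i>, 0]]"

definition sigma_z :: cmat where
  "sigma_z = vector [vector [1, 0], vector [0, -1]]"

definition I_x :: cmat where "I_x = (1/2::real) *\<^sub>R sigma_x"
definition I_y :: cmat where "I_y = (1/2::real) *\<^sub>R sigma_y"
definition I_z :: cmat where "I_z = (1/2::real) *\<^sub>R sigma_z"

definition cscale :: "complex \<Rightarrow> cmat \<Rightarrow> cmat" where
  "cscale c A = (\<chi> j k. c * A $ j $ k)"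

text \<open>Initial state |0><0|, |0> being the +1 eigenvector of sigma_z.\<close>
definition rho0 :: cmat where
  "rho0 = vector [vector [1, 0], vector [0, 0]]"

definition vN_rhs :: "(real \<Rightarrow> cmat) \<Rightarrow> (real \<Rightarrow> cmat) \<Rightarrow> real \<Rightarrow> cmat" where
  "vN_rhs H rho s = cscale (- \<i>) (H s ** rho s - rho s ** H s)"

text \<open>rho is a solution on [0,oo) of the von Neumann equation for the (possibly
  time-dependent, merely measurable) Hamiltonian H with initial state rho0,
  in the Caratheodory (integral) sense.\<close>
definition solves_vN :: "(real \<Rightarrow> cmat) \<Rightarrow> (real \<Rightarrow> cmat) \<Rightarrow> bool" where
  "solves_vN H rho \<longleftrightarrow> rho 0 = rho0 \<and>
     (\<forall>t\<ge>0. (vN_rhs H rho has_integral (rho t - rho 0)) {0..t})"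

text \<open>Bloch vector components: tr(rho sigma_k) (real for Hermitian rho).\<close>
definition bloch_x :: "cmat \<Rightarrow> real" where "bloch_x rho = Re (trace (rho ** sigma_x))"
definition bloch_y :: "cmat \<Rightarrow> real" where "bloch_y rho = Re (trace (rho ** sigma_y))"
definition bloch_z :: "cmat \<Rightarrow> real" where "bloch_z rho = Re (trace (rho ** sigma_z))"

end

theory Submission
  imports Defs
begin

text \<open>The Bloch vector satisfies \<open>x' = - y\<close>, \<open>y' = x - u z\<close>, \<open>z' = u y\<close> with control \<open>u\<close>. Fix a final
  time \<open>t\<close> and let \<open>W s\<close> be the height reached at time \<open>t\<close> if one switches at time \<open>s\<close> to the constant
  control \<open>- e\<close>. Then \<open>W' = (u + e) \<beta>\<close> for an explicit switching function \<open>\<beta>\<close>, so \<open>W\<close> increases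
  wherever \<open>\<beta> \<ge> 0\<close>. Suppose \<open>z\<close> first touches the height of the constant control run with a small time
  lag, say at time \<open>t\<close> with \<open>y t > 0\<close> (the other sign is symmetric, and \<open>y t = 0\<close> makes \<open>z\<close> stationary).
  Then \<open>\<beta> t > 0\<close>. Either \<open>\<beta>\<close> is nonnegative on all of \<open>[0, t]\<close>, and \<open>z t \<ge> W 0\<close> is too
  high, or \<open>\<beta>\<close> has a last zero \<open>s < t\<close>; before \<open>t\<close> the state is still above the lagged height, and
  spherical trigonometry gives the strict bound for \<open>W s \<le> z t\<close>. Letting the lag tend to zero
  yields the theorem.\<close>

section \<open>Products of indefinite integrals\<close>

text \<open>A quadratic bound makes the difference quotients at \<open>r\<close> at most
  \<open>C * \<bar>s - r\<bar>\<close>, so the derivative vanishes throughout the interval.\<close>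

lemma const_if_quadratic_modulus:
  fixes D :: "real \<Rightarrow> real"
  assumes ab: "a \<le> b"
    and D: "\<And>s r. s \<in> {a..b} \<Longrightarrow> r \<in> {a..b} \<Longrightarrow> \<bar>D s - D r\<bar> \<le> C * (s - r)\<^sup>2"
  shows "D a = D b"
proof -
  have "(D has_real_derivative 0) (at r within {a..b})" if r: "r \<in> {a..b}" for r
    unfolding has_field_derivative_iff
  proof (rule Lim_null_comparison)
    show "\<forall>\<^sub>F s in at r within {a..b}. norm ((D s - D r) / (s - r)) \<le> C * \<bar>s - r\<bar>"
      unfolding eventually_at_filter
    proof (intro always_eventually allI impI)
      fix s assume "s \<noteq> r" "s \<in> {a..b}"
      then show "norm ((D s - D r) / (s - r)) \<le> C * \<bar>s - r\<bar>"
        using D[OF _ r, of s] by (simp add: abs_divide divide_le_eq power2_eq_square mult.assoc)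
    qed
    show "((\<lambda>s. C * \<bar>s - r\<bar>) \<longlongrightarrow> 0) (at r within {a..b})"
      by (rule tendsto_eq_intros refl | simp)+
  qed
  then obtain c where "\<forall>s\<in>{a..b}. D s = c"
    using has_field_derivative_zero_constant[of "{a..b}" D] by auto
  then show ?thesis using ab by simp
qed


text \<open>Caratheodory primitives: \<open>f\<close> is only integrable, so \<open>F\<close> need not be differentiable everywhere.\<close>
definition antideriv_on :: "real \<Rightarrow> real \<Rightarrow> (real \<Rightarrow> real) \<Rightarrow> (real \<Rightarrow> real) \<Rightarrow> bool" where
  "antideriv_on a b f F \<longleftrightarrow>
     (\<forall>s r. a \<le> s \<longrightarrow> s \<le> r \<longrightarrow> r \<le> b \<longrightarrow> (f has_integral F r - F s) {s..r})"

lemma antideriv_onD: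
  "antideriv_on a b f F \<Longrightarrow> a \<le> s \<Longrightarrow> s \<le> r \<Longrightarrow> r \<le> b \<Longrightarrow> (f has_integral F r - F s) {s..r}"
  by (simp add: antideriv_on_def)

lemma antideriv_on_subset:
  "antideriv_on a b f F \<Longrightarrow> a \<le> s \<Longrightarrow> r \<le> b \<Longrightarrow> antideriv_on s r f F"
  by (simp add: antideriv_on_def)

lemma antideriv_onI:
  assumes "\<And>s. a \<le> s \<Longrightarrow> s \<le> b \<Longrightarrow> (f has_integral F s - F a) {a..s}"
  shows "antideriv_on a b f F"
  unfolding antideriv_on_def
proof (intro allI impI)
  fix s r assume sr: "a \<le> s" "s \<le> r" "r \<le> b"
  have s: "(f has_integral F s - F a) {a..s}" and r: "(f has_integral F r - F a) {a..r}"
    using assms sr by auto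
  have "f integrable_on {s..r}"
    by (rule integrable_subinterval_real[OF has_integral_integrable[OF r]]) (use sr in simp)
  then have i: "(f has_integral integral {s..r} f) {s..r}" by (rule integrable_integral)
  have "(f has_integral (F s - F a + integral {s..r} f)) {a..r}"
    using has_integral_combine[OF _ _ s i] sr by simp
  then have "F s - F a + integral {s..r} f = F r - F a"
    using r by (rule has_integral_unique)
  then have "integral {s..r} f = F r - F s" by simp
  then show "(f has_integral F r - F s) {s..r}" using i by simp
qed

lemma antideriv_on_add:
  "antideriv_on a b f F \<Longrightarrow> antideriv_on a b g G \<Longrightarrow>
    antideriv_on a b (\<lambda>s. f s + g s) (\<lambda>s. F s + G s)"
  unfolding antideriv_on_def
proof (intro allI impI)
  fix s r
  assume "\<forall>s r. a \<le> s \<longrightarrow> s \<le> r \<longrightarrow> r \<le> b \<longrightarrow> (f has_integral F r - F s) {s..r}"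
    and "\<forall>s r. a \<le> s \<longrightarrow> s \<le> r \<longrightarrow> r \<le> b \<longrightarrow> (g has_integral G r - G s) {s..r}"
    and "a \<le> s" "s \<le> r" "r \<le> b"
  then have "((\<lambda>s. f s + g s) has_integral (F r - F s) + (G r - G s)) {s..r}"
    by (intro has_integral_add) auto
  then show "((\<lambda>s. f s + g s) has_integral F r + G r - (F s + G s)) {s..r}"
    by (simp add: algebra_simps)
qed

lemma antideriv_on_FTC:
  assumes "\<And>s. a \<le> s \<Longrightarrow> s \<le> b \<Longrightarrow> (F has_real_derivative f s) (at s)"
  shows "antideriv_on a b f F"
  unfolding antideriv_on_def
proof (intro allI impI)
  fix s r assume "a \<le> s" "s \<le> r" "r \<le> b"
  then show "(f has_integral F r - F s) {s..r}"
    by (intro fundamental_theorem_of_calculus)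
      (simp_all add: has_field_derivative_at_within assms
            flip: has_real_derivative_iff_has_vector_derivative)
qed

lemma antideriv_on_continuous:
  assumes "antideriv_on a b f F"
  shows "continuous_on {a..b} F"
proof (cases "a \<le> b")
  case True
  have "F s = F a + integral {a..s} f" if "s \<in> {a..b}" for s
    using antideriv_onD[OF assms, of a s] that by (auto dest: integral_unique)
  moreover have "f integrable_on {a..b}"
    using antideriv_onD[OF assms, of a b] True by (auto simp: integrable_on_def)
  then have "continuous_on {a..b} (\<lambda>s. F a + integral {a..s} f)"
    by (intro continuous_intros indefinite_integral_continuous_1)
  ultimately show ?thesis using continuous_on_cong[of "{a..b}" "{a..b}" F] by metis
qed simp

lemma antideriv_on_lipschitz:
  assumes "antideriv_on a b f F" and f: "\<And>s. s \<in> {a..b} \<Longrightarrow> \<bar>f s\<bar> \<le> M"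
    and "s \<in> {a..b}" "r \<in> {a..b}"
  shows "\<bar>F r - F s\<bar> \<le> M * \<bar>r - s\<bar>"
proof -
  have *: "\<bar>F r - F s\<bar> \<le> M * \<bar>r - s\<bar>" if "a \<le> s" "s \<le> r" "r \<le> b" for s r
  proof -
    have "(f has_integral F r - F s) (cbox s r)" using antideriv_onD[OF assms(1)] that by simp
    moreover have "0 \<le> M" using f[of s] that by auto
    ultimately have "norm (F r - F s) \<le> M * measure lborel (cbox s r)"
      using f that by (intro has_integral_bound) auto
    then show ?thesis using that by simp
  qed
  show ?thesis
    using *[of s r] *[of r s] assms by (cases "s \<le> r") (auto simp: abs_minus_commute)
qed

text \<open>Both factors are Lipschitz, so the defect of the product formula is quadratic in the length of
  the interval and hence vanishes.\<close>
lemma antideriv_on_mult: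
  assumes F: "antideriv_on a b f F" and G: "antideriv_on a b g G"
    and bdd: "bounded (f ` {a..b})" "bounded (g ` {a..b})"
  shows "antideriv_on a b (\<lambda>s. f s * G s + F s * g s) (\<lambda>s. F s * G s)"
proof (cases "a \<le> b")
  case ab: True
  let ?h = "\<lambda>s. f s * G s + F s * g s"
  obtain M where "\<forall>v \<in> f ` {a..b} \<union> g ` {a..b}. norm v \<le> M"
    using bounded_Un[THEN iffD2, OF conjI[OF bdd]] by (meson bounded_iff)
  then have f: "\<And>s. s \<in> {a..b} \<Longrightarrow> \<bar>f s\<bar> \<le> M" and g: "\<And>s. s \<in> {a..b} \<Longrightarrow> \<bar>g s\<bar> \<le> M"
    by auto
  have M: "0 \<le> M" using f[of a] ab by auto
  \<comment> \<open>Gauge integrability alone does not survive multiplication by a continuous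
    factor. A bounded integrable function is absolutely integrable, and that property does
    survive.\<close>
  have prod: "(\<lambda>s. P s * p s) integrable_on {a..b}"
    if "antideriv_on a b p p'" "continuous_on {a..b} P" "\<And>s. s \<in> {a..b} \<Longrightarrow> \<bar>p s\<bar> \<le> M" for p p' P
  proof -
    have "p integrable_on {a..b}"
      using antideriv_onD[OF that(1), of a b] ab by (auto simp: integrable_on_def)
    then have "p absolutely_integrable_on {a..b}"
      by (rule absolutely_integrable_integrable_bound[where g = "\<lambda>_. M", rotated]) (use that(3) in auto)
    moreover have "P \<in> borel_measurable (lebesgue_on {a..b})"
      using that(2) by (intro continuous_imp_measurable_on_sets_lebesgue) auto
    moreover have "bounded (P ` {a..b})"
      using that(2) by (intro compact_imp_bounded compact_continuous_image) auto
    ultimately have "(\<lambda>s. P s * p s) absolutely_integrable_on {a..b}"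
      by (intro absolutely_integrable_bounded_measurable_product_real) auto
    then show ?thesis by (simp add: absolutely_integrable_on_def)
  qed
  have "(\<lambda>s. G s * f s + F s * g s) integrable_on {a..b}"
    using F G f g by (intro integrable_add prod antideriv_on_continuous)
  then have int: "?h integrable_on {a..b}" by (simp add: mult.commute)
  define D where "D s = F s * G s - integral {a..s} ?h" for s
  have D: "\<bar>D r - D s\<bar> \<le> 2 * M\<^sup>2 * (r - s)\<^sup>2" if sr: "a \<le> s" "s \<le> r" "r \<le> b" for s r
  proof -
    have "?h integrable_on {s..r}"
      using int sr by (intro integrable_subinterval_real[OF int]) auto
    then have h: "(?h has_integral integral {s..r} ?h) {s..r}" by (rule integrable_integral)
    have "integral {a..s} ?h + integral {s..r} ?h = integral {a..r} ?h"
      using sr integrable_subinterval_real[OF int, of a r] by (intro Henstock_Kurzweil_Integration.integral_combine) auto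
    \<comment> \<open>The product increment is split with \<open>G\<close> frozen at
      \<open>r\<close> and \<open>F\<close> at \<open>s\<close>. Subtracting \<open>?h\<close> then
      leaves a bounded density times an increment of order \<open>r - s\<close>.\<close>
    then have Deq: "D r - D s = (F r - F s) * G r + F s * (G r - G s) - integral {s..r} ?h"
      by (simp add: D_def algebra_simps)
    have "((\<lambda>\<tau>. f \<tau> * G r + F s * g \<tau> - ?h \<tau>) has_integral D r - D s) {s..r}"
      unfolding Deq using antideriv_onD[OF F sr] antideriv_onD[OF G sr]
      by (intro has_integral_diff has_integral_add has_integral_mult_left has_integral_mult_right h)
    then have "((\<lambda>\<tau>. f \<tau> * (G r - G \<tau>) + (F s - F \<tau>) * g \<tau>) has_integral D r - D s) (cbox s r)"
      by (simp add: algebra_simps)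
    moreover have "norm (f \<tau> * (G r - G \<tau>) + (F s - F \<tau>) * g \<tau>) \<le> 2 * M\<^sup>2 * (r - s)"
      if "\<tau> \<in> cbox s r" for \<tau>
    proof -
      have \<tau>: "s \<le> \<tau>" "\<tau> \<le> r" using that by auto
      have "\<bar>G r - G \<tau>\<bar> \<le> M * \<bar>r - \<tau>\<bar>" "\<bar>F s - F \<tau>\<bar> \<le> M * \<bar>s - \<tau>\<bar>"
        using \<tau> sr by (intro antideriv_on_lipschitz[OF G g] antideriv_on_lipschitz[OF F f]; simp)+
      then have "\<bar>G r - G \<tau>\<bar> \<le> M * (r - \<tau>)" "\<bar>F s - F \<tau>\<bar> \<le> M * (\<tau> - s)"
        using \<tau> by (simp_all add: abs_of_nonpos)
      then have "\<bar>f \<tau>\<bar> * \<bar>G r - G \<tau>\<bar> \<le> M * (M * (r - \<tau>))" "\<bar>F s - F \<tau>\<bar> * \<bar>g \<tau>\<bar> \<le> (M * (\<tau> - s)) * M"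
        using \<tau> sr M f[of \<tau>] g[of \<tau>] by (intro mult_mono; simp)+
      moreover have "norm (f \<tau> * (G r - G \<tau>) + (F s - F \<tau>) * g \<tau>)
          \<le> \<bar>f \<tau>\<bar> * \<bar>G r - G \<tau>\<bar> + \<bar>F s - F \<tau>\<bar> * \<bar>g \<tau>\<bar>"
        by (metis abs_triangle_ineq abs_mult real_norm_def)
      moreover have "M * (M * (r - \<tau>)) + (M * (\<tau> - s)) * M = M\<^sup>2 * (r - s)"
        by (simp add: power2_eq_square algebra_simps)
      moreover have "0 \<le> M\<^sup>2 * (r - s)" using sr by simp
      ultimately show ?thesis by linarith
    qed
    ultimately have "norm (D r - D s) \<le> 2 * M\<^sup>2 * (r - s) * measure lborel (cbox s r)"
      using sr by (intro has_integral_bound) auto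
    then show ?thesis using sr by (simp add: power2_eq_square mult.assoc)
  qed
  show ?thesis
  proof (rule antideriv_onI)
    fix s assume s: "a \<le> s" "s \<le> b"
    have "\<bar>D p - D q\<bar> \<le> 2 * M\<^sup>2 * (p - q)\<^sup>2" if "p \<in> {a..s}" "q \<in> {a..s}" for p q
      using D[of p q] D[of q p] that s
      by (cases "p \<le> q") (auto simp: abs_minus_commute power2_commute)
    then have "D a = D s" using s by (intro const_if_quadratic_modulus) auto
    then have "integral {a..s} ?h = F s * G s - F a * G a" by (simp add: D_def)
    moreover have "?h integrable_on {a..s}"
      using s by (intro integrable_subinterval_real[OF int]) auto
    ultimately show "(?h has_integral F s * G s - F a * G a) {a..s}"
      by (metis integrable_integral)
  qed
qed (simp add: antideriv_on_def)


lemma bounded_mult_real: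
  fixes f g :: "'a \<Rightarrow> real"
  assumes "bounded (f ` S)" "bounded (g ` S)"
  shows "bounded ((\<lambda>s. f s * g s) ` S)"
proof -
  obtain A B where "\<And>s. s \<in> S \<Longrightarrow> \<bar>f s\<bar> \<le> A" "\<And>s. s \<in> S \<Longrightarrow> \<bar>g s\<bar> \<le> B"
    using assms by (auto simp: bounded_iff)
  then have "\<bar>f s * g s\<bar> \<le> A * B" if "s \<in> S" for s
    unfolding abs_mult using that by (meson abs_ge_zero mult_mono order_trans)
  then show ?thesis by (auto simp: bounded_iff)
qed

lemma bounded_continuous_real:
  fixes f :: "real \<Rightarrow> real"
  shows "continuous_on {a..b} f \<Longrightarrow> bounded (f ` {a..b})"
  by (intro compact_imp_bounded compact_continuous_image) auto

section \<open>Bloch vectors under a constant control\<close>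

text \<open>The Bloch vector at time \<open>s\<close> under the constant control \<open>e\<close> is
  \<open>(rot_x e s, - rot_y e s, rot_z e s)\<close>. The reflection \<open>y \<mapsto> - y\<close> reverses time, so
  \<open>(rot_x e s, rot_y e s, rot_z e s)\<close> is the north pole transported backwards by \<open>s\<close>: the costate
  of the final height.\<close>
definition freq :: "real \<Rightarrow> real" where "freq e = sqrt (1 + e\<^sup>2)"
definition rot_x :: "real \<Rightarrow> real \<Rightarrow> real" where
  "rot_x e s = e * (1 - cos (freq e * s)) / (freq e)\<^sup>2"
definition rot_y :: "real \<Rightarrow> real \<Rightarrow> real" where
  "rot_y e s = e * sin (freq e * s) / freq e"
definition rot_z :: "real \<Rightarrow> real \<Rightarrow> real" where
  "rot_z e s = (1 + e\<^sup>2 * cos (freq e * s)) / (freq e)\<^sup>2"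

lemma freq_pos: "freq e > 0" by (simp add: freq_def add_pos_nonneg)
lemma freq_sq: "(freq e)\<^sup>2 = 1 + e\<^sup>2" by (simp add: freq_def)

lemma rot_0 [simp]: "rot_x e 0 = 0" "rot_y e 0 = 0" "rot_z e 0 = 1"
  using freq_pos[of e] by (simp_all add: rot_x_def rot_y_def rot_z_def flip: freq_sq)

lemma rot_x_deriv: "(rot_x e has_real_derivative rot_y e s) (at s)"
proof -
  have "((\<lambda>s. e * (1 - cos (freq e * s)) / (freq e)\<^sup>2) has_real_derivative
      e * (sin (freq e * s) * freq e) / (freq e)\<^sup>2) (at s)"
    by (rule DERIV_cdivide DERIV_cmult derivative_eq_intros refl | simp)+
  then show ?thesis
    using freq_pos[of e] by (simp add: rot_x_def[abs_def] rot_y_def power2_eq_square)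
qed

lemma rot_y_deriv: "(rot_y e has_real_derivative e * rot_z e s - rot_x e s) (at s)"
proof -
  have "e * rot_z e s - rot_x e s = (1 + e\<^sup>2) * e * cos (freq e * s) / (freq e)\<^sup>2"
    by (simp add: rot_z_def rot_x_def diff_divide_distrib[symmetric] algebra_simps power2_eq_square)
  also have "\<dots> = e * (cos (freq e * s) * freq e) / freq e"
    using freq_pos[of e] by (simp flip: freq_sq)
  finally have eq: "e * rot_z e s - rot_x e s = e * (cos (freq e * s) * freq e) / freq e" .
  show ?thesis unfolding eq rot_y_def[abs_def]
    by (rule DERIV_cdivide DERIV_cmult derivative_eq_intros refl | simp)+
qed

lemma rot_z_deriv: "(rot_z e has_real_derivative - (e * rot_y e s)) (at s)"
proof -
  have "((\<lambda>s. (1 + e\<^sup>2 * cos (freq e * s)) / (freq e)\<^sup>2) has_real_derivative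
      e\<^sup>2 * (- sin (freq e * s) * freq e) / (freq e)\<^sup>2) (at s)"
    by (rule DERIV_cdivide DERIV_cmult derivative_eq_intros refl | simp)+
  then show ?thesis
    using freq_pos[of e] by (simp add: rot_z_def[abs_def] rot_y_def power2_eq_square)
qed

section \<open>Bloch equations and the pairing with the costate\<close>

definition bloch_sol :: "(real \<Rightarrow> real) \<Rightarrow> (real \<Rightarrow> real) \<Rightarrow> (real \<Rightarrow> real) \<Rightarrow> (real \<Rightarrow> real) \<Rightarrow> real \<Rightarrow> bool" where
  "bloch_sol u x y z T \<longleftrightarrow> x 0 = 0 \<and> y 0 = 0 \<and> z 0 = 1 \<and>
     antideriv_on 0 T (\<lambda>s. - y s) x \<and>
     antideriv_on 0 T (\<lambda>s. x s - u s * z s) y \<and>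
     antideriv_on 0 T (\<lambda>s. u s * y s) z"

text \<open>A half turn about the z axis reverses the control and preserves heights. It reduces the
  case \<open>y t < 0\<close> to \<open>y t > 0\<close>.\<close>

lemma bloch_sol_flip:
  assumes "bloch_sol u x y z T"
  shows "bloch_sol (\<lambda>s. - u s) (\<lambda>s. - x s) (\<lambda>s. - y s) z T"
proof -
  have neg: "antideriv_on 0 T (\<lambda>s. - f s) (\<lambda>s. - F s)" if "antideriv_on 0 T f F" for f F
    unfolding antideriv_on_def
  proof (intro allI impI)
    fix s r assume "0 \<le> s" "s \<le> r" "r \<le> T"
    from has_integral_neg[OF antideriv_onD[OF that this]]
    show "((\<lambda>s. - f s) has_integral - F r - - F s) {s..r}" by simp
  qed
  have "antideriv_on 0 T (\<lambda>s. - (- y s)) (\<lambda>s. - x s)"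
       "antideriv_on 0 T (\<lambda>s. - (x s - u s * z s)) (\<lambda>s. - y s)"
    using assms by (auto simp only: bloch_sol_def intro!: neg)
  then show ?thesis using assms by (simp add: bloch_sol_def)
qed

lemma bloch_sol_continuous:
  assumes "bloch_sol u x y z T"
  shows "continuous_on {0..T} x" "continuous_on {0..T} y" "continuous_on {0..T} z"
  using assms unfolding bloch_sol_def by (blast intro: antideriv_on_continuous)+

lemma bloch_sol_bounded:
  assumes "bloch_sol u x y z T" "bounded (u ` {0..T})"
  shows "bounded ((\<lambda>s. - y s) ` {0..T})" "bounded ((\<lambda>s. x s - u s * z s) ` {0..T})"
    "bounded ((\<lambda>s. u s * y s) ` {0..T})"
proof -
  note b = bloch_sol_continuous[OF assms(1), THEN bounded_continuous_real]
  show "bounded ((\<lambda>s. - y s) ` {0..T})" using b(2) by (simp add: bounded_iff)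
  show "bounded ((\<lambda>s. x s - u s * z s) ` {0..T})"
    by (rule bounded_minus_comp[OF b(1) bounded_mult_real[OF assms(2) b(3)]])
  show "bounded ((\<lambda>s. u s * y s) ` {0..T})"
    by (rule bounded_mult_real[OF assms(2) b(2)])
qed

text \<open>The motion is an infinitesimal rotation: in the product formula for the squared length
  all terms cancel pointwise.\<close>

lemma bloch_sol_norm:
  assumes sol: "bloch_sol u x y z T" and u: "bounded (u ` {0..T})" and s: "s \<in> {0..T}"
  shows "(x s)\<^sup>2 + (y s)\<^sup>2 + (z s)\<^sup>2 = 1"
proof -
  note ad = sol[unfolded bloch_sol_def, THEN conjunct2, THEN conjunct2, THEN conjunct2]
  note bd = bloch_sol_bounded[OF sol u]
  have "antideriv_on 0 T (\<lambda>s. (- y s * x s + x s * - y s) +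
      ((x s - u s * z s) * y s + y s * (x s - u s * z s)) + (u s * y s * z s + z s * (u s * y s)))
    (\<lambda>s. x s * x s + y s * y s + z s * z s)"
    by (intro antideriv_on_add antideriv_on_mult ad[THEN conjunct1] ad[THEN conjunct2, THEN conjunct1]
        ad[THEN conjunct2, THEN conjunct2] bd)
  from antideriv_onD[OF this, of 0 s]
  have "((\<lambda>_. 0) has_integral (x s)\<^sup>2 + (y s)\<^sup>2 + (z s)\<^sup>2 - 1) {0..s}"
    using s sol by (simp add: bloch_sol_def power2_eq_square algebra_simps)
  then show ?thesis by (simp add: has_integral_0_eq)
qed

text \<open>The costate follows the same rotation with control \<open>e\<close>, so differentiating
  its pairing with the state leaves only the mismatch \<open>u s - e\<close>. The pairing runs from
  \<open>rot_z e t\<close> at time 0 to \<open>z t\<close> at time \<open>t\<close>.\<close>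

lemma bloch_sol_costate:
  assumes sol: "bloch_sol u x y z T" and u: "bounded (u ` {0..T})"
  shows "antideriv_on 0 T (\<lambda>s. (u s - e) * (rot_z e (t - s) * y s - rot_y e (t - s) * z s))
    (\<lambda>s. rot_x e (t - s) * x s + rot_y e (t - s) * y s + rot_z e (t - s) * z s)"
proof -
  note ad = sol[unfolded bloch_sol_def, THEN conjunct2, THEN conjunct2, THEN conjunct2]
  note bd = bloch_sol_bounded[OF sol u]
  have cont: "continuous_on {0..T} (\<lambda>s. rot_x e (t - s))" "continuous_on {0..T} (\<lambda>s. rot_y e (t - s))"
    "continuous_on {0..T} (\<lambda>s. rot_z e (t - s))"
    using freq_pos[of e] unfolding rot_x_def rot_y_def rot_z_def by (intro continuous_intros; simp)+
  have rot: "antideriv_on 0 T (\<lambda>s. - rot_y e (t - s)) (\<lambda>s. rot_x e (t - s))"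
    "antideriv_on 0 T (\<lambda>s. rot_x e (t - s) - e * rot_z e (t - s)) (\<lambda>s. rot_y e (t - s))"
    "antideriv_on 0 T (\<lambda>s. e * rot_y e (t - s)) (\<lambda>s. rot_z e (t - s))"
  proof -
    have d: "((\<lambda>s. t - s) has_real_derivative - 1) (at s)" for s
      using DERIV_diff[OF DERIV_const DERIV_ident] by simp
    show "antideriv_on 0 T (\<lambda>s. - rot_y e (t - s)) (\<lambda>s. rot_x e (t - s))"
      using DERIV_chain2[OF rot_x_deriv d] by (intro antideriv_on_FTC) simp
    show "antideriv_on 0 T (\<lambda>s. rot_x e (t - s) - e * rot_z e (t - s)) (\<lambda>s. rot_y e (t - s))"
      using DERIV_chain2[OF rot_y_deriv d] by (intro antideriv_on_FTC) simp
    show "antideriv_on 0 T (\<lambda>s. e * rot_y e (t - s)) (\<lambda>s. rot_z e (t - s))"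
      using DERIV_chain2[OF rot_z_deriv d] by (intro antideriv_on_FTC) simp
  qed
  have bdr: "bounded ((\<lambda>s. - rot_y e (t - s)) ` {0..T})"
    "bounded ((\<lambda>s. rot_x e (t - s) - e * rot_z e (t - s)) ` {0..T})"
    "bounded ((\<lambda>s. e * rot_y e (t - s)) ` {0..T})"
    by (intro bounded_continuous_real continuous_on_minus continuous_on_diff
        continuous_on_mult continuous_on_const cont)+
  have "antideriv_on 0 T (\<lambda>s. (- rot_y e (t - s) * x s + rot_x e (t - s) * - y s)
     + ((rot_x e (t - s) - e * rot_z e (t - s)) * y s + rot_y e (t - s) * (x s - u s * z s))
     + (e * rot_y e (t - s) * z s + rot_z e (t - s) * (u s * y s)))
    (\<lambda>s. rot_x e (t - s) * x s + rot_y e (t - s) * y s + rot_z e (t - s) * z s)"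
    by (intro antideriv_on_add antideriv_on_mult ad[THEN conjunct1] ad[THEN conjunct2, THEN conjunct1]
        ad[THEN conjunct2, THEN conjunct2] bd rot bdr)
  then show ?thesis by (simp add: algebra_simps)
qed

lemma bloch_sol_const:
  assumes "bloch_sol (\<lambda>_. e) x y z t" "0 \<le> t"
  shows "z t = rot_z e t"
  using antideriv_onD[OF bloch_sol_costate[OF assms(1), of e t], of 0 t] assms
  by (auto simp: bloch_sol_def image_constant_conv)

section \<open>Trigonometry of the constant control\<close>

lemma rot_minus [simp]: "rot_x (- e) s = - rot_x e s" "rot_y (- e) s = - rot_y e s"
    "rot_z (- e) s = rot_z e s"
  by (simp_all add: rot_x_def rot_y_def rot_z_def freq_def)

lemma add_divide_common_square:
  fixes A B D W :: real
  shows "W \<noteq> 0 \<Longrightarrow> A / W\<^sup>2 + B / W + D / W\<^sup>2 = (A + B * W + D) / W\<^sup>2"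
  by (simp add: field_simps power2_eq_square)

lemma rot_norm: "(rot_x e s)\<^sup>2 + (rot_y e s)\<^sup>2 + (rot_z e s)\<^sup>2 = 1"
proof -
  define c where "c = cos (freq e * s)"
  have s2: "(sin (freq e * s))\<^sup>2 = 1 - c\<^sup>2" by (simp add: c_def sin_squared_eq)
  have "(e * (1 - c))\<^sup>2 + e\<^sup>2 * (1 - c\<^sup>2) * (1 + e\<^sup>2) + (1 + e\<^sup>2 * c)\<^sup>2 = (1 + e\<^sup>2)\<^sup>2"
    by algebra
  moreover have "1 + e\<^sup>2 \<noteq> 0" using freq_pos[of e] by (simp flip: freq_sq)
  ultimately show ?thesis
    unfolding rot_x_def rot_y_def rot_z_def power_divide power_mult_distrib[of e "sin _"] s2
      c_def[symmetric] freq_sq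
    by (subst add_divide_common_square) simp_all
qed

text \<open>The right side pairs the state after time \<open>s\<close> with the costate for the
  remaining time \<open>t\<close>, which gives the height after time \<open>s + t\<close>.\<close>

lemma rot_z_add: "rot_z e (s + t) = rot_x e t * rot_x e s - rot_y e t * rot_y e s + rot_z e t * rot_z e s"
proof -
  \<comment> \<open>The sines occur only in the product \<open>p\<close>, so the identity becomes
    polynomial once denominators are cleared.\<close>
  define c c' p where "c = cos (freq e * s)" and "c' = cos (freq e * t)"
    and "p = sin (freq e * t) * sin (freq e * s)"
  define W where "W = (freq e)\<^sup>2"
  have W: "W = 1 + e\<^sup>2" by (simp add: W_def freq_sq)
  have W0: "W \<noteq> 0" using freq_pos[of e] by (simp add: W_def)
  have "rot_y e t * rot_y e s = e\<^sup>2 * p / W"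
    by (simp add: rot_y_def p_def W_def power2_eq_square)
  then have "rot_x e t * rot_x e s - rot_y e t * rot_y e s + rot_z e t * rot_z e s
    = e\<^sup>2 * ((1 - c') * (1 - c)) / W\<^sup>2 + (- (e\<^sup>2 * p)) / W + (1 + e\<^sup>2 * c') * (1 + e\<^sup>2 * c) / W\<^sup>2"
    by (simp add: rot_x_def rot_z_def W_def c_def c'_def power2_eq_square)
  also have "\<dots> = (e\<^sup>2 * ((1 - c') * (1 - c)) + (- (e\<^sup>2 * p)) * W + (1 + e\<^sup>2 * c') * (1 + e\<^sup>2 * c)) / W\<^sup>2"
    by (rule add_divide_common_square) (rule W0)
  also have "\<dots> = (W * (1 + e\<^sup>2 * (c * c' - p))) / W\<^sup>2"
    unfolding W by (simp add: algebra_simps power2_eq_square)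
  also have "\<dots> = (1 + e\<^sup>2 * (c * c' - p)) / W"
    using W0 by (simp add: power2_eq_square)
  also have "\<dots> = rot_z e (s + t)"
    by (simp add: rot_z_def W_def c_def c'_def p_def distrib_left cos_add mult.commute)
  finally show ?thesis by (rule sym)
qed

lemma rot_z_strict_antimono:
  assumes "e \<noteq> 0" "0 \<le> s" "s < t" "freq e * t \<le> pi"
  shows "rot_z e t < rot_z e s"
proof -
  have "freq e * s < freq e * t" using assms freq_pos by simp
  then have "cos (freq e * t) < cos (freq e * s)"
    using assms freq_pos[of e] by (intro cos_monotone_0_pi) auto
  then show ?thesis using assms freq_pos[of e] by (simp add: rot_z_def divide_strict_right_mono)
qed

section \<open>Where the constant control is not locally optimal\<close>

text \<open>In the application \<open>(- X, Y, \<zeta>)\<close> is the state of the reference run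
  with control \<open>- e\<close>, and \<open>(- a, - b, d)\<close> is its costate. Eliminating
  \<open>y\<close> by \<open>beta\<close> turns the claim into an upper bound on
  \<open>a * x\<close>, and the unit ball bounds the square of \<open>x\<close>. Here
  \<open>h1\<close> and \<open>h2\<close> give the weak inequality at height \<open>\<zeta>\<close>,
  and \<open>h3\<close> makes the margin between the squares grow with
  \<open>z - \<zeta>\<close>.\<close>

lemma gain_if_costate_z_pos:
  fixes a b d X Y \<zeta> x y z :: real
  assumes pos: "a > 0" "b > 0" "d > 0" "X > 0" "Y > 0"
    and p1: "a\<^sup>2 + b\<^sup>2 + d\<^sup>2 = 1" and q1: "X\<^sup>2 + Y\<^sup>2 + \<zeta>\<^sup>2 = 1"
    and h1: "2 * a * d * (b * X + a * Y) \<le> (a\<^sup>2 + b\<^sup>2) * (d * Y + b * \<zeta>)"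
    and h2: "a * X \<le> b * Y"
    and h3: "d * (a * X - b * Y + d * \<zeta>) \<le> \<zeta>"
    and r1: "x\<^sup>2 + y\<^sup>2 + z\<^sup>2 \<le> 1" and beta: "d * y + b * z = 0" and z: "\<zeta> < z"
  shows "a * X - b * Y + d * \<zeta> < d * z - a * x - b * y"
proof -
  \<comment> \<open>At height \<open>\<zeta>\<close>, \<open>g\<close> is the drop in
    \<open>y\<close> from the reference state to the plane \<open>d * y + b * z = 0\<close>;
    \<open>d * g\<close> is the switching function at the reference state. \<open>l\<close> is the
    gain at the point of that plane with height \<open>\<zeta>\<close> and
    \<open>x = 0\<close>.\<close>
  define g where "g = Y + b * \<zeta> / d"
  define l where "l = b * g - a * X"
  define \<delta> where "\<delta> = z - \<zeta>"
  define q2 where "q2 = b\<^sup>2 + d\<^sup>2"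
  have dpos: "\<delta> > 0" using z by (simp add: \<delta>_def)
  have y: "y = - (b / d) * z" using beta pos by (simp add: field_simps)
  have dg: "d * g = d * Y + b * \<zeta>" using pos by (simp add: g_def field_simps)
  have h1': "2 * a * (b * X + a * Y) \<le> (a\<^sup>2 + b\<^sup>2) * g"
  proof -
    have "d * (2 * a * (b * X + a * Y)) \<le> d * ((a\<^sup>2 + b\<^sup>2) * g)"
      using h1 by (simp add: dg[symmetric] mult.left_commute mult.assoc)
    then show ?thesis using pos by simp
  qed
  have lhs_pos: "0 < 2 * a * (b * X + a * Y)" using pos by (simp add: add_pos_pos)
  have gpos: "g > 0"
  proof (rule ccontr)
    assume "\<not> g > 0"
    then have "(a\<^sup>2 + b\<^sup>2) * g \<le> 0" by (simp add: mult_nonneg_nonpos)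
    then show False using h1' lhs_pos by linarith
  qed
  have l0: "l \<ge> 0"
  proof -
    have "a\<^sup>2 * (a * X) \<le> a\<^sup>2 * (b * Y)" using h2 by (intro mult_left_mono) auto
    moreover have "0 \<le> b\<^sup>2 * (a * X)" "0 \<le> a\<^sup>2 * (b * Y)" using pos by simp_all
    moreover have "b * (2 * a * (b * X + a * Y)) \<le> b * ((a\<^sup>2 + b\<^sup>2) * g)"
      using h1' pos by (intro mult_left_mono) auto
    ultimately have "(a\<^sup>2 + b\<^sup>2) * (a * X) \<le> (a\<^sup>2 + b\<^sup>2) * (b * g)"
      by (simp add: algebra_simps power2_eq_square)
    then have "a * X \<le> b * g" using pos by (simp add: sum_power2_gt_zero_iff)
    then show ?thesis by (simp add: l_def)
  qed
  \<comment> \<open>The factor of \<open>a\<^sup>2\<close> is the bound that the unit ball puts on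
    \<open>x\<^sup>2\<close> in the plane at height \<open>\<zeta>\<close>.\<close>
  have l2: "a\<^sup>2 * (1 - q2 * \<zeta>\<^sup>2 / d\<^sup>2) \<le> l\<^sup>2"
  proof -
    have e1: "q2 * \<zeta>\<^sup>2 / d\<^sup>2 = \<zeta>\<^sup>2 + (g - Y)\<^sup>2"
      using pos by (simp add: g_def q2_def field_simps power2_eq_square)
    have e2: "1 - q2 * \<zeta>\<^sup>2 / d\<^sup>2 = X\<^sup>2 + g * (2 * Y - g)"
      unfolding e1 using q1 by (simp add: power2_eq_square algebra_simps)
    have "l\<^sup>2 - a\<^sup>2 * (X\<^sup>2 + g * (2 * Y - g)) = g * ((a\<^sup>2 + b\<^sup>2) * g - 2 * a * (b * X + a * Y))"
      by (simp add: l_def power2_eq_square algebra_simps)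
    moreover have "\<dots> \<ge> 0" using gpos h1' by simp
    ultimately show ?thesis unfolding e2 by linarith
  qed
  have key: "d * z - a * x - b * y - (a * X - b * Y + d * \<zeta>) = l + q2 / d * \<delta> - a * x"
    using pos unfolding y l_def g_def q2_def \<delta>_def by (simp add: field_simps power2_eq_square)
  have x2: "x\<^sup>2 \<le> 1 - q2 / d\<^sup>2 * z\<^sup>2"
    using r1 pos unfolding y q2_def by (simp add: field_simps power2_eq_square)
  have "(a * x)\<^sup>2 < (l + q2 / d * \<delta>)\<^sup>2"
  proof -
    have "(a * x)\<^sup>2 \<le> a\<^sup>2 * (1 - q2 / d\<^sup>2 * z\<^sup>2)"
      unfolding power_mult_distrib using x2 by (intro mult_left_mono) auto
    also have "\<dots> = a\<^sup>2 * (1 - q2 * \<zeta>\<^sup>2 / d\<^sup>2) - a\<^sup>2 * q2 / d\<^sup>2 * (2 * \<zeta> * \<delta> + \<delta>\<^sup>2)"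
      using pos by (simp add: \<delta>_def power2_eq_square field_simps)
    also have "\<dots> \<le> l\<^sup>2 - a\<^sup>2 * q2 / d\<^sup>2 * (2 * \<zeta> * \<delta> + \<delta>\<^sup>2)"
      using l2 by simp
    also have "\<dots> < l\<^sup>2 + 2 * (q2 / d * \<delta>) * l + (q2 / d * \<delta>)\<^sup>2"
    proof -
      \<comment> \<open>This rewrites \<open>h3\<close> as nonnegativity of the coefficient that is
        linear in \<open>\<delta>\<close>.\<close>
      have z0: "d * l + a\<^sup>2 * \<zeta> = \<zeta> - d * (a * X - b * Y + d * \<zeta>)"
        using dg p1 unfolding l_def by algebra
      have q: "q2 > 0" using pos by (simp add: q2_def add_pos_pos)
      have "0 < (q2 / d\<^sup>2) * (2 * \<delta> * (d * l + a\<^sup>2 * \<zeta>) + (a\<^sup>2 + q2) * \<delta>\<^sup>2)"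
        using z0 h3 dpos pos q by (intro mult_pos_pos add_nonneg_pos) (auto intro!: add_pos_pos)
      also have "\<dots> = 2 * (q2 / d * \<delta>) * l + (q2 / d * \<delta>)\<^sup>2 + a\<^sup>2 * q2 / d\<^sup>2 * (2 * \<zeta> * \<delta> + \<delta>\<^sup>2)"
        using pos by (simp add: field_simps power2_eq_square)
      finally show ?thesis by linarith
    qed
    also have "\<dots> = (l + q2 / d * \<delta>)\<^sup>2"
      by (simp add: power2_eq_square algebra_simps)
    finally show ?thesis .
  qed
  moreover have "0 \<le> l + q2 / d * \<delta>" using l0 dpos pos by (simp add: q2_def)
  ultimately have "a * x < l + q2 / d * \<delta>" by (rule power_less_imp_less_base)
  then show ?thesis using key by linarith
qed

text \<open>This rules out a costate of nonpositive height in \<open>costate_gain\<close>: where the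
  switching function vanishes, no state is above the reference. There
  \<open>f = 2 / (1 + e\<^sup>2)\<close>, \<open>f - 1\<close> is the lowest height of the reference
  orbit, and the hypothesis linking \<open>a\<close> and \<open>d\<close> is the squared equation
  \<open>e * a = 1 - d\<close> of the orbit plane.\<close>

lemma height_le_if_costate_z_nonpos:
  fixes a b d f y z \<zeta> :: real
  assumes b: "b > 0" and f: "f > 0" and d: "d \<le> 0" "f - 1 \<le> d" and z0: "f - d \<le> \<zeta>"
    and p1: "a\<^sup>2 + b\<^sup>2 + d\<^sup>2 = 1" and a: "a\<^sup>2 * (2 - f) = f * (1 - d)\<^sup>2"
    and r1: "y\<^sup>2 + z\<^sup>2 \<le> 1" and beta: "d * y + b * z = 0" 
  shows "z \<le> \<zeta>"
proof (rule ccontr)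
  assume "\<not> z \<le> \<zeta>"
  then have z: "z > f - d" "f - d > 0" using z0 f d by auto
  define m where "m = - d"
  have m: "0 \<le> m" "m \<le> 1 - f" using d by (auto simp: m_def)
  \<comment> \<open>The line \<open>d * y + b * z = 0\<close> cuts the unit disc in a diameter,
    whose height is limited by its slope.\<close>
  have q: "(b\<^sup>2 + d\<^sup>2) * z\<^sup>2 \<le> d\<^sup>2"
  proof -
    have "(b * z)\<^sup>2 = (d * y)\<^sup>2" using beta by (simp add: add_eq_0_iff2)
    then have "(b\<^sup>2 + d\<^sup>2) * z\<^sup>2 = d\<^sup>2 * (y\<^sup>2 + z\<^sup>2)" by (simp add: power_mult_distrib algebra_simps)
    also have "\<dots> \<le> d\<^sup>2 * 1" using r1 by (intro mult_left_mono) auto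
    finally show ?thesis by simp
  qed
  have fm: "f + m \<le> 1" "0 < f + m" "1 + m \<le> 2 - f" using m f by auto
  \<comment> \<open>The base of the square is at most each of the two factors on the right.\<close>
  have "((1 + m) * (f + m))\<^sup>2 \<le> (2 - f) * (f + 2 * m)"
  proof -
    have "(1 + m) * (f + m) \<le> (2 - f) * 1" using fm m by (intro mult_mono) auto
    moreover have "m * (f + m) \<le> m * 1" using fm m by (intro mult_left_mono) auto
    then have "(1 + m) * (f + m) \<le> f + 2 * m" by (simp add: algebra_simps)
    moreover have "0 \<le> (1 + m) * (f + m)" using fm m by simp
    ultimately show ?thesis unfolding power2_eq_square using fm by (intro mult_mono) auto
  qed
  \<comment> \<open>The orbit equation eliminates \<open>a\<close>, so the wanted bound on
    \<open>m\<^sup>2\<close> is the previous estimate in another form.\<close>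
  then have "0 \<le> f * ((2 - f) * (f + 2 * m) - ((1 + m) * (f + m))\<^sup>2)" using f by simp
  also have "\<dots> = (2 - f) * ((f + m)\<^sup>2 * (1 - a\<^sup>2) - m\<^sup>2)"
    using a unfolding m_def by algebra
  finally have "m\<^sup>2 \<le> (f + m)\<^sup>2 * (1 - a\<^sup>2)" using fm m by (simp add: zero_le_mult_iff)
  then have "d\<^sup>2 \<le> (b\<^sup>2 + d\<^sup>2) * (f - d)\<^sup>2" proof -
    have "1 - a\<^sup>2 = b\<^sup>2 + d\<^sup>2" using p1 by simp
    then show ?thesis using \<open>m\<^sup>2 \<le> _\<close> by (simp add: m_def mult.commute)
  qed
  moreover have "b\<^sup>2 + d\<^sup>2 > 0" using b by (simp add: add_pos_nonneg)
  moreover have "(f - d)\<^sup>2 < z\<^sup>2" using z by (intro power_strict_mono) auto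
  ultimately have "d\<^sup>2 < (b\<^sup>2 + d\<^sup>2) * z\<^sup>2"
    by (meson mult_less_cancel_left_pos order_le_less_trans)
  then show False using q by linarith
qed

text \<open>A state that lies above the height of the constant control, at a point where the switching
  function vanishes, still ends strictly higher. The factor \<open>q * C - p * S = cos (A + B)\<close> below is where
  the time bound enters.\<close>
lemma costate_gain:
  assumes e: "e > 0" and s: "s > 0" "\<sigma> > 0" "freq e * (s + \<sigma>) < pi"
    and r1: "x\<^sup>2 + y\<^sup>2 + z\<^sup>2 \<le> 1" and beta: "rot_z e \<sigma> * y + rot_y e \<sigma> * z = 0"
    and z: "rot_z e s < z"
  shows "rot_z e (s + \<sigma>) < rot_z e \<sigma> * z - rot_x e \<sigma> * x - rot_y e \<sigma> * y"
proof -
  define w where "w = freq e"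
  define W where "W = w\<^sup>2"
  \<comment> \<open>Half angles make the coordinates polynomial in four sines and cosines, up to
    powers of \<open>w\<close>, and turn the time bound into \<open>A + B < pi / 2\<close>.\<close>
  define A where "A = w * s / 2"
  define B where "B = w * \<sigma> / 2"
  have w: "w > 0" and W: "W = 1 + e\<^sup>2" "W > 1" using freq_pos[of e] freq_sq[of e] e by (auto simp: w_def W_def)
  have AB: "A > 0" "B > 0" "A + B < pi / 2" using s w by (auto simp: A_def B_def w_def field_simps)
  define S C p q where "S = sin A" and "C = cos A" and "p = sin B" and "q = cos B"
  have pos: "S > 0" "C > 0" "p > 0" "q > 0"
    using AB by (auto simp: S_def C_def p_def q_def intro: sin_gt_zero cos_gt_zero)
  have SC: "S\<^sup>2 + C\<^sup>2 = 1" "p\<^sup>2 + q\<^sup>2 = 1" by (auto simp: S_def C_def p_def q_def)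
  have "cos (A + B) > 0" using AB by (intro cos_gt_zero_pi) auto
  then have lt: "p * S < q * C" by (simp add: cos_add S_def C_def p_def q_def mult.commute)
  have dbl: "cos (freq e * s) = C\<^sup>2 - S\<^sup>2" "sin (freq e * s) = 2 * S * C"
    "cos (freq e * \<sigma>) = q\<^sup>2 - p\<^sup>2" "sin (freq e * \<sigma>) = 2 * p * q"
    using cos_double[of A] sin_double[of A] cos_double[of B] sin_double[of B]
    by (simp_all add: A_def B_def w_def S_def C_def p_def q_def)
  define a b d X Y \<zeta> where "a = rot_x e \<sigma>" and "b = rot_y e \<sigma>" and "d = rot_z e \<sigma>"
    and "X = rot_x e s" and "Y = rot_y e s" and "\<zeta> = rot_z e s"
  have a: "a = 2 * e * p\<^sup>2 / W" and b: "b = 2 * e * p * q / w"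
    and d: "d = (W * q\<^sup>2 + (2 - W) * p\<^sup>2) / W"
    and X: "X = 2 * e * S\<^sup>2 / W" and Y: "Y = 2 * e * S * C / w"
    and \<zeta>: "\<zeta> = (W * C\<^sup>2 + (2 - W) * S\<^sup>2) / W"
  proof -
    have "1 - (q\<^sup>2 - p\<^sup>2) = 2 * p\<^sup>2" "1 - (C\<^sup>2 - S\<^sup>2) = 2 * S\<^sup>2"
      "1 + e\<^sup>2 * (q\<^sup>2 - p\<^sup>2) = W * q\<^sup>2 + (2 - W) * p\<^sup>2"
      "1 + e\<^sup>2 * (C\<^sup>2 - S\<^sup>2) = W * C\<^sup>2 + (2 - W) * S\<^sup>2"
      using SC W(1) by algebra+
    then show "a = 2 * e * p\<^sup>2 / W" "d = (W * q\<^sup>2 + (2 - W) * p\<^sup>2) / W" "X = 2 * e * S\<^sup>2 / W"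
      "\<zeta> = (W * C\<^sup>2 + (2 - W) * S\<^sup>2) / W"
      by (simp_all add: a_def d_def X_def \<zeta>_def rot_x_def rot_z_def dbl W_def w_def)
    show "b = 2 * e * p * q / w" "Y = 2 * e * S * C / w"
      by (simp_all add: b_def Y_def rot_y_def dbl w_def)
  qed
  have abXY: "a > 0" "b > 0" "X > 0" "Y > 0" using pos e w W(2) by (simp_all add: a b X Y)
  have add: "rot_z e (s + \<sigma>) = a * X - b * Y + d * \<zeta>"
    by (simp add: rot_z_add a_def b_def d_def X_def Y_def \<zeta>_def)
  have norm: "a\<^sup>2 + b\<^sup>2 + d\<^sup>2 = 1" "X\<^sup>2 + Y\<^sup>2 + \<zeta>\<^sup>2 = 1"
    by (simp_all add: a_def b_def d_def X_def Y_def \<zeta>_def rot_norm)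
  show ?thesis
  proof (cases "d > 0")
    case True
    have h1: "2 * a * d * (b * X + a * Y) \<le> (a\<^sup>2 + b\<^sup>2) * (d * Y + b * \<zeta>)"
    proof -
      have "(a\<^sup>2 + b\<^sup>2) * (d * Y + b * \<zeta>) - 2 * a * d * (b * X + a * Y) =
        8 * e ^ 3 * p\<^sup>2 / (w * W ^ 3) * (p * C + q * S) *
          (W\<^sup>2 * q\<^sup>2 * (q * C - p * S) + p\<^sup>2 * (W * (q * C) - (2 - W) * (p * S)))"
      proof -
        \<comment> \<open>Arbitrary numerators separate the clearing of denominators, which uses the
          definition of \<open>W\<close> as the square of \<open>w\<close>, from the polynomial
          identity \<open>num\<close>.\<close>
        have frac: "((k / W)\<^sup>2 + (l / w)\<^sup>2) * (m / W * (n / w) + l / w * (o' / W))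
            - 2 * (k / W) * (m / W) * (l / w * (r / W) + k / W * (n / w))
          = ((k\<^sup>2 + l\<^sup>2 * W) * (m * n + l * o') - 2 * k * m * (l * r + k * n)) / (w * W ^ 3)"
          for k l m n o' r :: real
          using w unfolding W_def by (simp add: field_simps power2_eq_square power3_eq_cube)
        have num: "((2 * e * p\<^sup>2)\<^sup>2 + (2 * e * p * q)\<^sup>2 * W) *
            ((W * q\<^sup>2 + (2 - W) * p\<^sup>2) * (2 * e * S * C) + 2 * e * p * q * (W * C\<^sup>2 + (2 - W) * S\<^sup>2)) -
            2 * (2 * e * p\<^sup>2) * (W * q\<^sup>2 + (2 - W) * p\<^sup>2) *
            (2 * e * p * q * (2 * e * S\<^sup>2) + 2 * e * p\<^sup>2 * (2 * e * S * C))
          = 8 * e ^ 3 * p\<^sup>2 * ((p * C + q * S) *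
          (W\<^sup>2 * q\<^sup>2 * (q * C - p * S) + p\<^sup>2 * (W * (q * C) - (2 - W) * (p * S))))"
          by (simp add: algebra_simps power2_eq_square power3_eq_cube)
        show ?thesis
          unfolding a b d X Y \<zeta> frac num by simp
      qed
      moreover have "\<dots> \<ge> 0"
      proof -
        have "(2 - W) * (p * S) \<le> W * (p * S)" using W pos by (intro mult_right_mono) auto
        also have "\<dots> \<le> W * (q * C)" using lt W by (intro mult_left_mono) auto
        finally show ?thesis using lt W w e pos by (intro mult_nonneg_nonneg add_nonneg_nonneg divide_nonneg_nonneg) auto
      qed
      ultimately show ?thesis by linarith
    qed
    have h2: "a * X \<le> b * Y"
    proof -
      have "p * S \<le> W * (q * C)"
      proof -
        have "1 * (q * C) \<le> W * (q * C)" using W(2) pos by (intro mult_right_mono) simp_all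
        then show ?thesis using lt by linarith
      qed
      then have "4 * e\<^sup>2 * (p * S) * (p * S) \<le> 4 * e\<^sup>2 * (p * S) * (W * (q * C))"
        using pos by (intro mult_left_mono) auto
      then show ?thesis unfolding a b X Y W_def using w by (simp add: field_simps power2_eq_square)
    qed
    have h3: "d * (a * X - b * Y + d * \<zeta>) \<le> \<zeta>"
    proof -
      \<comment> \<open>Writing \<open>s\<close> as the difference of \<open>s + \<sigma>\<close>
        and \<open>\<sigma>\<close>, whose angles both lie strictly between 0 and \<open>pi\<close>,
        leaves only nonnegative terms.\<close>
      define c1 s1 c2 s2 where "c1 = cos (freq e * \<sigma>)" and "s1 = sin (freq e * \<sigma>)"
        and "c2 = cos (freq e * (s + \<sigma>))" and "s2 = sin (freq e * (s + \<sigma>))"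
      have cs: "cos (freq e * s) = c1 * c2 + s1 * s2"
      proof -
        have eq: "freq e * s = freq e * (s + \<sigma>) - freq e * \<sigma>" by (simp add: distrib_left)
        show ?thesis
          unfolding eq cos_diff c1_def[symmetric] c2_def[symmetric] s1_def[symmetric] s2_def[symmetric]
          by (simp only: mult.commute)
      qed
      have "freq e * \<sigma> < freq e * (s + \<sigma>)" using freq_pos s by simp
      then have "freq e * \<sigma> < pi" using s by linarith
      then have "s1 > 0" "s2 > 0" using s freq_pos[of e] by (auto simp: s1_def s2_def intro!: sin_gt_zero)
      have "\<zeta> - d * rot_z e (s + \<sigma>) = (e\<^sup>2 * ((1 - c1) * (1 - c2) + s1 * s2) + e ^ 4 * (s1 * s2)) / W\<^sup>2"
      proof -
        define v where "v = e\<^sup>2"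
        have "(1 + v * (c1 * c2 + s1 * s2)) / W - (1 + v * c1) / W * ((1 + v * c2) / W) =
          (W * (1 + v * (c1 * c2 + s1 * s2)) - (1 + v * c1) * (1 + v * c2)) / W\<^sup>2"
          using W(2) by (simp add: field_simps power2_eq_square)
        also have "\<dots> = (v * ((1 - c1) * (1 - c2) + s1 * s2) + v\<^sup>2 * (s1 * s2)) / W\<^sup>2"
          unfolding W(1) v_def[symmetric] by (simp add: algebra_simps power2_eq_square)
        finally show ?thesis
          unfolding \<zeta>_def d_def rot_z_def cs
          unfolding c1_def[symmetric] c2_def[symmetric]
          unfolding w_def[symmetric] W_def[symmetric]
          by (simp add: v_def)
      qed
      moreover have "\<dots> \<ge> 0"
        using \<open>s1 > 0\<close> \<open>s2 > 0\<close> 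
        by (intro divide_nonneg_nonneg add_nonneg_nonneg mult_nonneg_nonneg) (auto simp: c1_def c2_def)
      ultimately show ?thesis unfolding add by linarith
    qed
    show ?thesis unfolding add
      using gain_if_costate_z_pos[OF abXY(1,2) True abXY(3,4) norm h1 h2 h3 r1] beta z
      by (simp add: a_def b_def d_def \<zeta>_def)
  next
    case False
    \<comment> \<open>This contradicts the assumed height, so the case is vacuous.\<close>
    have "z \<le> \<zeta>"
    proof (rule height_le_if_costate_z_nonpos)
      show "b > 0" by fact
      show "2 / W > 0" using W(2) by simp
      show "d \<le> 0" using False by simp
      have "2 / W - 1 = (2 - W) * (p\<^sup>2 + q\<^sup>2) / W"
        unfolding SC(2) using W(2) by (simp add: field_simps)
      also have "\<dots> \<le> d"
      proof -
        have "(2 - W) * q\<^sup>2 \<le> W * q\<^sup>2" using W(2) by (intro mult_right_mono) auto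
        then show ?thesis
          unfolding d using W(2) by (intro divide_right_mono) (simp_all add: distrib_left)
      qed
      finally show "2 / W - 1 \<le> d" .
      \<comment> \<open>The time bound again: squaring \<open>p * S < q * C\<close> and eliminating
        \<open>p\<close> and \<open>C\<close> leaves this inequality.\<close>
      have "S\<^sup>2 \<le> q\<^sup>2"
      proof -
        have "(p * S)\<^sup>2 \<le> (q * C)\<^sup>2" using lt pos by (intro power_mono) auto
        moreover have "p\<^sup>2 = 1 - q\<^sup>2" "C\<^sup>2 = 1 - S\<^sup>2" using SC by linarith+
        ultimately show ?thesis by (simp add: power_mult_distrib algebra_simps)
      qed
      then have "0 \<le> (2 * W - 2) * (q\<^sup>2 - S\<^sup>2) / W" using W(2) by simp
      also have "\<dots> = \<zeta> + d - 2 / W"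
      proof -
        have C2: "C\<^sup>2 = 1 - S\<^sup>2" and p2: "p\<^sup>2 = 1 - q\<^sup>2" using SC by linarith+
        have "(2 * W - 2) * (q\<^sup>2 - S\<^sup>2) =
          W * C\<^sup>2 + (2 - W) * S\<^sup>2 + (W * q\<^sup>2 + (2 - W) * p\<^sup>2) - 2"
          unfolding C2 p2 by (simp add: algebra_simps)
        then show ?thesis unfolding \<zeta> d by (simp only: add_divide_distrib diff_divide_distrib)
      qed
      finally show "2 / W - d \<le> \<zeta>" by simp
      show "a\<^sup>2 + b\<^sup>2 + d\<^sup>2 = 1" by fact
      show "a\<^sup>2 * (2 - 2 / W) = 2 / W * (1 - d)\<^sup>2"
      proof -
        have "1 - d = 2 * e\<^sup>2 * p\<^sup>2 / W"
        proof -
          have "1 - d = (W * (p\<^sup>2 + q\<^sup>2) - (W * q\<^sup>2 + (2 - W) * p\<^sup>2)) / W"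
            unfolding SC(2) d using W(2) by (simp add: field_simps)
          also have "\<dots> = 2 * (W - 1) * p\<^sup>2 / W" by (simp add: algebra_simps)
          also have "\<dots> = 2 * e\<^sup>2 * p\<^sup>2 / W" unfolding W(1) by simp
          finally show ?thesis .
        qed
        moreover have "2 - 2 / W = 2 * e\<^sup>2 / W" 
        proof -
          have "2 - 2 / W = 2 * (W - 1) / W" using W(2) by (simp add: field_simps)
          then show ?thesis unfolding W(1) by simp
        qed
        ultimately show ?thesis unfolding a by (simp add: power_mult_distrib power_divide power2_eq_square mult_ac)
      qed
      show "y\<^sup>2 + z\<^sup>2 \<le> 1" using r1 zero_le_power2[of x] by linarith
      show "d * y + b * z = 0" using beta by (simp add: b_def d_def)
    qed
    then show ?thesis using z by (simp add: \<zeta>_def)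
  qed
qed


section \<open>Comparison with a lagged constant control\<close>

text \<open>Behind the last zero of the switching function \<open>\<beta>\<close> the predicted final height \<open>W\<close> increases;
  at that zero the lag makes \<open>costate_gain\<close> applicable.\<close>
lemma bloch_sol_beats_lag_pos:
  assumes sol: "bloch_sol u x y z t" and e: "e > 0" and u: "\<And>s. s \<in> {0..t} \<Longrightarrow> \<bar>u s\<bar> \<le> e"
    and t: "t > 0" "L > 0" "freq e * (t + L) < pi"
    and ahead: "\<And>s. 0 \<le> s \<Longrightarrow> s < t \<Longrightarrow> rot_z e (s + L) < z s" and y: "y t > 0"
  shows "rot_z e (t + L) < z t"
proof -
  define \<beta> where "\<beta> s = rot_z e (t - s) * y s + rot_y e (t - s) * z s" for s
  define W where "W s = rot_z e (t - s) * z s - rot_x e (t - s) * x s - rot_y e (t - s) * y s" for s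
  have bdd: "bounded (u ` {0..t})" using u by (auto intro!: boundedI[where B = e])
  \<comment> \<open>Pairing with the costate of \<open>- e\<close> gives the factor
    \<open>u s + e\<close>, which is never negative.\<close>
  have W: "antideriv_on 0 t (\<lambda>s. (u s + e) * \<beta> s) W"
    using bloch_sol_costate[OF sol bdd, of "- e" t] unfolding \<beta>_def W_def by (simp add: algebra_simps)
  have W_mono: "W s \<le> W t" if s: "0 \<le> s" "s \<le> t" and \<beta>: "\<And>r. s \<le> r \<Longrightarrow> r \<le> t \<Longrightarrow> 0 \<le> \<beta> r" for s
  proof -
    have "0 \<le> W t - W s"
    proof (rule has_integral_nonneg)
      show "((\<lambda>s. (u s + e) * \<beta> s) has_integral W t - W s) {s..t}"
        using antideriv_onD[OF W] s by simp
      show "0 \<le> (u r + e) * \<beta> r" if "r \<in> {s..t}" for r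
        using u[of r] \<beta>[of r] that s by (intro mult_nonneg_nonneg) auto
    qed
    then show ?thesis by simp
  qed
  have Wt: "W t = z t" by (simp add: W_def)
  have \<beta>t: "\<beta> t > 0" using y by (simp add: \<beta>_def)
  have tL: "freq e * t < freq e * (t + L)" using t freq_pos by simp
  show ?thesis
  proof (cases "\<forall>r\<in>{0..t}. 0 \<le> \<beta> r")
    case True
    \<comment> \<open>Here \<open>W\<close> increases all the way from the north pole, and the lag
      supplies the strict inequality.\<close>
    have "rot_z e (t + L) < rot_z e t"
      using t e tL by (intro rot_z_strict_antimono) auto
    also have "\<dots> = W 0" using sol by (simp add: W_def bloch_sol_def)
    also have "\<dots> \<le> z t" using True t W_mono[of 0] Wt by simp
    finally show ?thesis .
  next
    case False
    then obtain r0 where r0: "0 \<le> r0" "r0 \<le> t" "\<beta> r0 < 0" by force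
    have cont: "continuous_on {0..t} \<beta>"
      using freq_pos[of e] bloch_sol_continuous[OF sol]
      unfolding \<beta>_def rot_y_def rot_z_def by (intro continuous_intros) auto
    \<comment> \<open>Since \<open>\<beta>\<close> is positive at \<open>t\<close>, every
      nonpositive value is followed by a zero.\<close>
    have zero: "\<exists>r'. r \<le> r' \<and> r' \<le> t \<and> \<beta> r' = 0" if "0 \<le> r" "r \<le> t" "\<beta> r \<le> 0" for r
      using that \<beta>t continuous_on_subset[OF cont, of "{r..t}"] by (intro IVT') auto
    define Z where "Z = {r \<in> {0..t}. \<beta> r = 0}"
    have "closed Z" unfolding Z_def
      using cont by (intro continuous_closed_preimage_constant) auto
    moreover have "Z \<subseteq> {0..t}" by (auto simp: Z_def)
    ultimately have "compact Z" by (meson bounded_closed_interval bounded_subset compact_eq_bounded_closed)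
    moreover have "Z \<noteq> {}" using zero[of r0] r0 by (fastforce simp: Z_def)
    ultimately obtain s where "s \<in> Z" and last: "\<And>r. r \<in> Z \<Longrightarrow> r \<le> s"
      using compact_attains_sup by metis
    then have s: "0 \<le> s" "s \<le> t" "\<beta> s = 0" by (auto simp: Z_def)
    then have "s < t" using \<beta>t by (cases "s = t") auto
    have "0 \<le> \<beta> r" if "s \<le> r" "r \<le> t" for r
    proof (rule ccontr)
      assume neg: "\<not> 0 \<le> \<beta> r"
      then have "\<exists>r'. r \<le> r' \<and> r' \<le> t \<and> \<beta> r' = 0" using that s(1) by (intro zero) simp_all
      then obtain r' where r': "r \<le> r'" "r' \<le> t" "\<beta> r' = 0" by blast
      then have "r' \<le> s" using last that s by (auto simp: Z_def)
      then have "r = s" using that r' by simp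
      then show False using neg s by simp
    qed
    then have "W s \<le> z t" using W_mono[of s] s Wt by simp
    moreover have eq: "(s + L) + (t - s) = t + L" by simp
    \<comment> \<open>The reference has run for \<open>s + L\<close> and has \<open>t - s\<close>
      left. The lag keeps the first time positive even if \<open>s = 0\<close>.\<close>
    moreover have "rot_z e ((s + L) + (t - s)) < W s"
      unfolding W_def
    proof (rule costate_gain)
      show "freq e * (s + L + (t - s)) < pi" unfolding eq by (rule t(3))
      show "rot_z e (t - s) * y s + rot_y e (t - s) * z s = 0" using s by (simp add: \<beta>_def)
      show "(x s)\<^sup>2 + (y s)\<^sup>2 + (z s)\<^sup>2 \<le> 1" using bloch_sol_norm[OF sol bdd] s by simp
    qed (use e s t \<open>s < t\<close> ahead in auto)
    ultimately show ?thesis unfolding eq by linarith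
  qed
qed

text \<open>At \<open>y t = 0\<close> the bound
  \<open>\<bar>u s * y s\<bar> \<le> e * \<bar>y s\<bar>\<close> makes \<open>z\<close> stationary
  from the left, although \<open>u\<close> may be discontinuous. The lagged height is still falling
  strictly, so the lead \<open>z s - rot_z e (s + L)\<close>, positive before \<open>t\<close>, is
  larger still at \<open>t\<close>.\<close>

lemma bloch_sol_beats_lag_zero:
  assumes sol: "bloch_sol u x y z t" and e: "e > 0" and u: "\<And>s. s \<in> {0..t} \<Longrightarrow> \<bar>u s\<bar> \<le> e"
    and t: "t > 0" "L > 0" "freq e * (t + L) < pi"
    and ahead: "\<And>s. 0 \<le> s \<Longrightarrow> s < t \<Longrightarrow> rot_z e (s + L) < z s" and y: "y t = 0"
  shows "rot_z e (t + L) < z t"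
proof -
  have z: "antideriv_on 0 t (\<lambda>s. u s * y s) z" using sol by (simp add: bloch_sol_def)
  have "(z has_real_derivative 0) (at t within {0..t})"
    unfolding has_field_derivative_iff
  proof (rule tendstoI)
    fix \<eta> :: real assume \<eta>: "\<eta> > 0"
    have "continuous (at t within {0..t}) y"
      using bloch_sol_continuous[OF sol] t by (simp add: continuous_on_eq_continuous_within)
    then obtain \<delta> where \<delta>: "\<delta> > 0" "\<And>s. s \<in> {0..t} \<Longrightarrow> dist s t < \<delta> \<Longrightarrow> \<bar>y s\<bar> < \<eta> / (2 * e)"
      using \<eta> e unfolding continuous_within_eps_delta y dist_real_def
      by (metis diff_zero divide_pos_pos mult_pos_pos zero_less_numeral)
    show "\<forall>\<^sub>F s in at t within {0..t}. dist ((z s - z t) / (s - t)) 0 < \<eta>"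
      unfolding eventually_at
    proof (intro exI[of _ \<delta>] conjI ballI impI)
      fix s assume s: "s \<in> {0..t}" "s \<noteq> t \<and> dist s t < \<delta>"
      have "\<bar>u r * y r\<bar> \<le> \<eta> / 2" if "r \<in> {s..t}" for r
      proof -
        have "\<bar>u r\<bar> * \<bar>y r\<bar> \<le> e * (\<eta> / (2 * e))"
          using u[of r] \<delta>(2)[of r] that s e by (intro mult_mono) (auto simp: dist_real_def)
        then show ?thesis using e by (simp add: abs_mult)
      qed
      then have "\<bar>z t - z s\<bar> \<le> \<eta> / 2 * \<bar>t - s\<bar>"
        using antideriv_on_subset[OF z, of s t] s
        by (intro antideriv_on_lipschitz[where f = "\<lambda>s. u s * y s" and a = s and b = t]) auto
      then have "\<bar>z s - z t\<bar> / \<bar>s - t\<bar> \<le> \<eta> / 2"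
        using s by (simp add: divide_le_eq abs_minus_commute)
      moreover have "dist ((z s - z t) / (s - t)) 0 = \<bar>z s - z t\<bar> / \<bar>s - t\<bar>"
        by (simp add: abs_divide)
      ultimately show "dist ((z s - z t) / (s - t)) 0 < \<eta>" using \<eta> by linarith
    qed fact
  qed
  moreover have "((\<lambda>s. rot_z e (s + L)) has_real_derivative - (e * rot_y e (t + L))) (at t within {0..t})"
  proof -
    have "((\<lambda>s. s + L) has_real_derivative 1) (at t)"
      using DERIV_add[OF DERIV_ident DERIV_const] by simp
    from DERIV_chain2[OF rot_z_deriv this] show ?thesis by (simp add: has_field_derivative_at_within)
  qed
  ultimately have "((\<lambda>s. z s - rot_z e (s + L)) has_real_derivative e * rot_y e (t + L)) (at t within {0..t})"
    using DERIV_diff by fastforce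
  moreover have "0 < e * rot_y e (t + L)"
    using e t freq_pos[of e] by (auto simp: rot_y_def intro!: mult_pos_pos divide_pos_pos sin_gt_zero)
  ultimately obtain d where d: "d > 0"
    "\<forall>h>0. t - h \<in> {0..t} \<longrightarrow> h < d \<longrightarrow> z (t - h) - rot_z e (t - h + L) < z t - rot_z e (t + L)"
    by (blast dest: has_real_derivative_pos_inc_left)
  define h where "h = min t d / 2"
  have "0 < h" "h < d" "h < t" using t d by (auto simp: h_def)
  then show ?thesis using d(2)[rule_format, of h] ahead[of "t - h"] by auto
qed

lemma bloch_sol_subinterval: "bloch_sol u x y z T \<Longrightarrow> t \<le> T \<Longrightarrow> bloch_sol u x y z t"
  unfolding bloch_sol_def by (meson antideriv_on_subset order_refl)

text \<open>Otherwise compactness gives a first time at which the lead is lost, and each sign of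
  \<open>y\<close> there yields a contradiction.\<close>

lemma bloch_sol_beats_lag:
  assumes sol: "bloch_sol u x y z T" and e: "e > 0" and u: "\<And>s. s \<in> {0..T} \<Longrightarrow> \<bar>u s\<bar> \<le> e"
    and T: "T \<ge> 0" "L > 0" "freq e * (T + L) < pi"
  shows "rot_z e (T + L) < z T"
proof (rule ccontr)
  assume contra: "\<not> ?thesis"
  define S where "S = {s \<in> {0..T}. z s - rot_z e (s + L) \<le> 0}"
  have "continuous_on {0..T} (\<lambda>s. z s - rot_z e (s + L))"
    using freq_pos[of e] bloch_sol_continuous[OF sol] unfolding rot_z_def
    by (intro continuous_intros) auto
  then have "closed ({0..T} \<inter> (\<lambda>s. z s - rot_z e (s + L)) -` {..0})"
    by (intro continuous_closed_preimage) auto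
  also have "{0..T} \<inter> (\<lambda>s. z s - rot_z e (s + L)) -` {..0} = S" by (auto simp: S_def)
  finally have "closed S" .
  moreover have "S \<subseteq> {0..T}" by (auto simp: S_def)
  ultimately have "compact S" by (meson bounded_closed_interval bounded_subset compact_eq_bounded_closed)
  moreover have "S \<noteq> {}" using contra T by (auto simp: S_def)
  ultimately obtain t where "t \<in> S" and first: "\<And>s. s \<in> S \<Longrightarrow> t \<le> s"
    using compact_attains_inf by metis
  then have t: "0 \<le> t" "t \<le> T" "z t \<le> rot_z e (t + L)" by (auto simp: S_def)
  have ahead: "rot_z e (s + L) < z s" if "0 \<le> s" "s < t" for s
    using first[of s] that t by (force simp: S_def)
  have fT: "freq e * (t + L) \<le> freq e * (T + L)" "freq e * L \<le> freq e * (T + L)"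
    using t T freq_pos[of e] by auto
  \<comment> \<open>The lag gives a head start at time 0, so the first failure occurs at a positive
    time.\<close>
  have "rot_z e L < 1"
    using rot_z_strict_antimono[of e 0 L] T e fT by simp
  then have "t \<noteq> 0" using t sol by (auto simp: bloch_sol_def)
  then have t': "t > 0" "freq e * (t + L) < pi" using t T fT by auto
  have sol': "bloch_sol u x y z t" using bloch_sol_subinterval[OF sol] t by simp
  have u': "\<bar>u s\<bar> \<le> e" "\<bar>- u s\<bar> \<le> e" if "s \<in> {0..t}" for s using u[of s] that t by auto
  consider "y t > 0" | "y t = 0" | "- y t > 0" by linarith
  then have "rot_z e (t + L) < z t"
  proof cases
    case 1
    show ?thesis by (rule bloch_sol_beats_lag_pos[OF sol' e u'(1) t'(1) T(2) t'(2) ahead 1])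
  next
    case 2
    show ?thesis by (rule bloch_sol_beats_lag_zero[OF sol' e u'(1) t'(1) T(2) t'(2) ahead 2])
  next
    case 3
    show ?thesis
      by (rule bloch_sol_beats_lag_pos[OF bloch_sol_flip[OF sol'] e u'(2) t'(1) T(2) t'(2) ahead 3])
  qed
  then show False using t by simp
qed

text \<open>The strict comparison is applied at time \<open>t - L n\<close> with lag
  \<open>L n / 2\<close>. The reference time \<open>t - L n / 2\<close> then stays below the half
  period even when \<open>freq e * t = pi\<close>, and continuity gives the limit.\<close>

lemma bloch_sol_z_ge:
  assumes sol: "bloch_sol u x y z t" and e: "e > 0" and u: "\<And>s. s \<in> {0..t} \<Longrightarrow> \<bar>u s\<bar> \<le> e"
    and t: "0 \<le> t" "freq e * t \<le> pi"
  shows "rot_z e t \<le> z t"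
proof (cases "t = 0")
  case True
  then show ?thesis using sol by (simp add: bloch_sol_def)
next
  case False
  then have t0: "t > 0" using t by simp
  \<comment> \<open>The shift by 2 keeps \<open>L n\<close> strictly below \<open>t\<close> already
    at \<open>n = 0\<close>.\<close>
  define L where "L n = t / real (n + 2)" for n
  have L: "0 < L n" "L n < t" for n
    using t0 divide_strict_left_mono[of 1 "real (n + 2)" t] by (simp_all add: L_def)
  have Llim: "L \<longlonglongrightarrow> 0" unfolding L_def
    by (rule LIMSEQ_ignore_initial_segment[OF lim_const_over_n])
  have lt: "rot_z e (t - L n / 2) < z (t - L n)" for n
  proof -
    have "rot_z e ((t - L n) + L n / 2) < z (t - L n)"
    proof (rule bloch_sol_beats_lag)
      show "bloch_sol u x y z (t - L n)" using bloch_sol_subinterval[OF sol] L(1)[of n] by simp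
      have "freq e * (t - L n + L n / 2) < freq e * t" using freq_pos[of e] L(1)[of n] by simp
      then show "freq e * (t - L n + L n / 2) < pi" using t by linarith
    qed (use e u L[of n] in auto)
    then show ?thesis by simp
  qed
  have "(\<lambda>n. t - L n / 2) \<longlonglongrightarrow> t - 0 / 2" by (intro tendsto_intros Llim) simp
  then have "(\<lambda>n. t - L n / 2) \<longlonglongrightarrow> t" by simp
  with DERIV_isCont[OF rot_z_deriv] have "(\<lambda>n. rot_z e (t - L n / 2)) \<longlonglongrightarrow> rot_z e t"
    by (rule isCont_tendsto_compose)
  moreover have "(\<lambda>n. z (t - L n)) \<longlonglongrightarrow> z t"
  proof (rule continuous_on_tendsto_compose[OF bloch_sol_continuous(3)[OF sol]])
    show "(\<lambda>n. t - L n) \<longlonglongrightarrow> t" using tendsto_diff[OF tendsto_const Llim, of t] by simp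
    show "\<forall>\<^sub>F n in sequentially. t - L n \<in> {0..t}"
      using L by (intro always_eventually) (simp add: less_imp_le)
  qed (use t in simp)
  ultimately show ?thesis using lt less_imp_le by (blast intro: LIMSEQ_le)
qed

section \<open>From the von Neumann equation to the Bloch equations\<close>

lemma bloch_linear: "bounded_linear bloch_x" "bounded_linear bloch_y" "bounded_linear bloch_z"
  by (auto intro!: linearI simp: linear_conv_bounded_linear[symmetric] bloch_x_def bloch_y_def bloch_z_def
      sigma_x_def sigma_y_def sigma_z_def trace_def matrix_matrix_mult_def sum_2 vector_2 algebra_simps)

text \<open>Multiplied by -i, the commutators of the Pauli matrices with the Hamiltonian have real
  coefficients, so the real parts of the traces form a closed system.\<close>

lemma bloch_vN_rhs:
  assumes "H s = I_z + u *\<^sub>R I_x"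
  shows "bloch_x (vN_rhs H rho s) = - bloch_y (rho s)"
    "bloch_y (vN_rhs H rho s) = bloch_x (rho s) - u * bloch_z (rho s)"
    "bloch_z (vN_rhs H rho s) = u * bloch_y (rho s)"
  using assms
  by (auto simp: bloch_x_def bloch_y_def bloch_z_def vN_rhs_def cscale_def I_x_def I_z_def
      sigma_x_def sigma_y_def sigma_z_def trace_def matrix_matrix_mult_def sum_2 vector_2 algebra_simps)

lemma solves_vN_bloch_sol:
  assumes "solves_vN (\<lambda>s. I_z + u s *\<^sub>R I_x) rho"
  shows "bloch_sol u (\<lambda>s. bloch_x (rho s)) (\<lambda>s. bloch_y (rho s)) (\<lambda>s. bloch_z (rho s)) T"
proof -
  let ?H = "\<lambda>s. I_z + u s *\<^sub>R I_x"
  have int: "antideriv_on 0 T (\<lambda>s. l (vN_rhs ?H rho s)) (\<lambda>s. l (rho s))" if l: "bounded_linear l" for l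
  proof (rule antideriv_onI)
    fix s :: real assume "0 \<le> s"
    then have "(vN_rhs ?H rho has_integral rho s - rho 0) {0..s}" using assms unfolding solves_vN_def by blast
    from has_integral_linear[OF this l]
    show "((\<lambda>s. l (vN_rhs ?H rho s)) has_integral l (rho s) - l (rho 0)) {0..s}"
      by (simp add: o_def bounded_linear.linear[OF l] linear_diff)
  qed
  have "rho 0 = rho0" using assms by (simp add: solves_vN_def)
  then have "bloch_x (rho 0) = 0" "bloch_y (rho 0) = 0" "bloch_z (rho 0) = 1"
    by (simp_all add: rho0_def bloch_x_def bloch_y_def bloch_z_def sigma_x_def sigma_y_def sigma_z_def
        trace_def matrix_matrix_mult_def sum_2 vector_2)
  then show ?thesis
    using bloch_linear[THEN int] by (simp add: bloch_sol_def bloch_vN_rhs[where H = ?H, OF refl])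
qed

theorem theorem1:
  fixes epsbar epst t :: real and eps :: "real \<Rightarrow> real"
    and rho_a rho_b :: "real \<Rightarrow> complex^2^2"
  assumes "epsbar > 0"
    and "set_borel_measurable lborel {0..} eps"
    and "\<forall>s\<ge>0. \<bar>eps s\<bar> \<le> epsbar"
    and "epst \<in> {epsbar, - epsbar}"
    and "solves_vN (\<lambda>s. I_z + eps s *\<^sub>R I_x) rho_a"
    and "solves_vN (\<lambda>s. I_z + epst *\<^sub>R I_x) rho_b"
    and "0 \<le> t" and "t \<le> pi / sqrt (1 + epsbar\<^sup>2)"
  shows "bloch_z (rho_a t) \<ge> bloch_z (rho_b t)"
proof -
  have "bloch_z (rho_b t) = rot_z epst t"
    using bloch_sol_const[OF solves_vN_bloch_sol[OF assms(6)]] assms(7) by simp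
  \<comment> \<open>Both signs of the constant control give the same height, because
    \<open>rot_z\<close> is even in the control.\<close>
  also have "\<dots> = rot_z epsbar t" using assms(4) by auto
  also have "\<dots> \<le> bloch_z (rho_a t)"
  proof (rule bloch_sol_z_ge[OF solves_vN_bloch_sol[OF assms(5)] assms(1)])
    show "freq epsbar * t \<le> pi"
      using assms(8) freq_pos[of epsbar] by (simp add: freq_def[symmetric] le_divide_eq mult.commute)
  qed (use assms in auto)
  finally show ?thesis .
qed

end
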